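(* Let $m,d$ be positive integers, let $U_{m,d}$ be the uniform matroid of rank $d$ on $m+d$ elements, and let $z_{m,d}^i$ be the coefficient of $t^i$ in its $Z$-polynomial $Z_{U_{m,d}}(t)$. Then $z_{m,d}^d=1$, and for every $0\le i\le d-1$, \[ z_{m,d}^i=\frac{\binom{d+2m}{i+m}\binom{d}{i}}{\binom{d+2m}{m}}\sum_{h=1}^{m}\frac{(-1)^{h+1}h}{m}\binom{i+m}{m-h}\binom{d-i-h+m-1}{m-1}. \]
   Context: Binomial coefficients are $\binom{x}{h}=x(x-1)\cdots(x-h+1)/h!$ for integers $h\ge0$. For a loopless matroid $M$ with lattice of flats $L(M)$, characteristic polynomial $\chi_M(t)$ and rank $\operatorname{rk}M$, the Kazhdan–Lusztig polynomial $P_M(t)$ is the unique assignment with $P_M=1$ if $\operatorname{rk}M=0$, $\deg P_M<\frac12\operatorname{rk}M$ if $\operatorname{rk}M>0$, and $t^{\operatorname{rk}M}P_M(t^{-1})=\sum_{F\in L(M)}\chi_{M_F}(t)P_{M^F}(t)$, where $M_F$ is the restriction of $M$ to the flat $F$ and $M^F$ is the contraction of $M$ by $F$. The $Z$-polynomial is $Z_M(t)=\sum_{F\in L(M)}t^{\operatorname{rk}M_F}P_{M^F}(t)$. *)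

theory Defs
  imports "HOL-Computational_Algebra.Polynomial" Complex_Main
begin

section \<open>Finite matroids\<close>

datatype 'a matroid = Matroid (ground: "'a set") (indep: "'a set set")

definition is_matroid :: "'a matroid \<Rightarrow> bool" where
  "is_matroid M \<longleftrightarrow>
     finite (ground M) \<and> indep M \<subseteq> Pow (ground M) \<and> {} \<in> indep M \<and>
     (\<forall>I\<in>indep M. \<forall>J. J \<subseteq> I \<longrightarrow> J \<in> indep M) \<and>
     (\<forall>I\<in>indep M. \<forall>J\<in>indep M. card I < card J \<longrightarrow> (\<exists>x\<in>J - I. insert x I \<in> indep M))"

definition loopless :: "'a matroid \<Rightarrow> bool" where
  "loopless M \<longleftrightarrow> (\<forall>x\<in>ground M. {x} \<in> indep M)"

definition rank_of :: "'a matroid \<Rightarrow> 'a set \<Rightarrow> nat" where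
  "rank_of M A = Max (card ` {I \<in> indep M. I \<subseteq> A})"

definition rk :: "'a matroid \<Rightarrow> nat" where
  "rk M = rank_of M (ground M)"

definition flats :: "'a matroid \<Rightarrow> 'a set set" where
  "flats M = {F. F \<subseteq> ground M \<and> (\<forall>x\<in>ground M - F. rank_of M F < rank_of M (insert x F))}"

definition restriction :: "'a matroid \<Rightarrow> 'a set \<Rightarrow> 'a matroid" where
  "restriction M F = Matroid F {I \<in> indep M. I \<subseteq> F}"

definition contraction :: "'a matroid \<Rightarrow> 'a set \<Rightarrow> 'a matroid" where
  "contraction M F = Matroid (ground M - F)
     {I. I \<subseteq> ground M - F \<and>
         (\<exists>B\<in>indep M. B \<subseteq> F \<and> card B = rank_of M F \<and> I \<union> B \<in> indep M)}"

definition uniform_matroid :: "'a set \<Rightarrow> nat \<Rightarrow> 'a matroid" where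
  "uniform_matroid E d = Matroid E {I. I \<subseteq> E \<and> card I \<le> d}"

section \<open>The characteristic polynomial\<close>

text \<open>The Moebius function of a finite family \<open>L\<close> of sets, ordered by inclusion.\<close>

function moebius :: "'a set set \<Rightarrow> 'a set \<Rightarrow> 'a set \<Rightarrow> int" where
  "moebius L X Y =
     (if X = Y then 1
      else if finite L \<and> X \<subset> Y then - (\<Sum>Z\<in>{Z \<in> L. X \<subseteq> Z \<and> Z \<subset> Y}. moebius L X Z)
      else 0)"
  by pat_completeness auto
termination
proof (relation "measure (\<lambda>(L, X, Y). card {W \<in> L. W \<subset> Y})", goal_cases)
  case 1
  show ?case by simp
next
  case (2 L X Y Z)
  then have "{W \<in> L. W \<subset> Z} \<subset> {W \<in> L. W \<subset> Y}" "finite {W \<in> L. W \<subset> Y}"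
    by auto
  then show ?case by (simp add: psubset_card_mono)
qed

declare moebius.simps [simp del]

text \<open>\<open>\<Inter>(flats M)\<close> is the bottom element of the lattice of flats; it is empty if \<open>M\<close> is loopless.\<close>

definition char_poly :: "'a matroid \<Rightarrow> int poly" where
  "char_poly M =
     (\<Sum>F\<in>flats M. monom (moebius (flats M) (\<Inter>(flats M)) F) (rk M - rank_of M F))"

section \<open>Kazhdan--Lusztig polynomials and Z-polynomials\<close>

text \<open>\<open>rev_poly n p\<close> is \<open>t ^ n * p (1 / t)\<close>, meaningful for \<open>degree p \<le> n\<close>; recall
  that \<open>reflect_poly p\<close> is \<open>t ^ degree p * p (1 / t)\<close>.\<close>

definition rev_poly :: "nat \<Rightarrow> int poly \<Rightarrow> int poly" where
  "rev_poly n p = monom 1 (n - degree p) * reflect_poly p"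

definition KL_assignment :: "('a matroid \<Rightarrow> int poly) \<Rightarrow> bool" where
  "KL_assignment P \<longleftrightarrow>
     (\<forall>M. is_matroid M \<and> loopless M \<longrightarrow>
        (rk M = 0 \<longrightarrow> P M = 1) \<and>
        (rk M > 0 \<longrightarrow> 2 * degree (P M) < rk M) \<and>
        rev_poly (rk M) (P M) =
          (\<Sum>F\<in>flats M. char_poly (restriction M F) * P (contraction M F)))"

text \<open>An assignment is determined by the conditions above only on loopless matroids, so the
  description is applied to its value at \<open>M\<close> rather than to the whole function.\<close>

definition KL_poly :: "'a matroid \<Rightarrow> int poly" where
  "KL_poly M = (THE p. \<exists>P. KL_assignment P \<and> P M = p)"

definition Z_poly :: "'a matroid \<Rightarrow> int poly" where
  "Z_poly M = (\<Sum>F\<in>flats M. monom 1 (rk (restriction M F)) * KL_poly (contraction M F))"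

end

theory Submission imports Defs begin

text \<open>Moebius inversion shows that the defining equation of the Kazhdan--Lusztig polynomials holds
  for all loopless matroids if and only if all \<open>Z\<close>-polynomials are palindromic. So \<open>P_M\<close> is the
  unique polynomial of degree less than \<open>rk M / 2\<close> that completes the contributions of the nonempty
  flats to a palindromic polynomial, which gives existence and uniqueness.

  For \<open>U_{m,d}\<close> this says that the numbers \<open>z\<^sup>i\<close> are determined by \<open>z\<^sup>d = 1\<close>, the symmetry
  \<open>z\<^sup>i = z\<^sup>d\<^sup>-\<^sup>i\<close>, and the vanishing for \<open>d \<le> 2i < 2d\<close> of the binomial inverse
  \<open>\<Sum>k\<le>i. (-1)\<^sup>k (m+d choose k) z_{m,d-k}\<^sup>i\<^sup>-\<^sup>k\<close>. For the claimed closed form the symmetry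
  follows from a recurrence of Pascal type, and the vanishing holds because, up to a constant
  factor, the inverse is an \<open>i\<close>-th difference of a polynomial of degree less than \<open>i\<close>.\<close>

section \<open>Bases and rank\<close>

definition is_basis :: "'a matroid \<Rightarrow> 'a set \<Rightarrow> 'a set \<Rightarrow> bool" where
  "is_basis M A B \<longleftrightarrow> B \<in> indep M \<and> B \<subseteq> A \<and> card B = rank_of M A"

lemma is_basisD:
  assumes "is_basis M A B"
  shows "B \<in> indep M" "B \<subseteq> A" "card B = rank_of M A"
  using assms by (auto simp: is_basis_def)

context
  fixes M :: "'a matroid"
  assumes M: "is_matroid M"
begin

lemma finite_ground: "finite (ground M)"
  using M by (simp add: is_matroid_def)

lemma empty_indep: "{} \<in> indep M"
  using M by (simp add: is_matroid_def)

lemma indep_subset_ground: "I \<in> indep M \<Longrightarrow> I \<subseteq> ground M"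
  using M by (auto simp: is_matroid_def)

lemma finite_indep: "I \<in> indep M \<Longrightarrow> finite I"
  using finite_ground indep_subset_ground finite_subset by blast

lemma indep_subset: "I \<in> indep M \<Longrightarrow> J \<subseteq> I \<Longrightarrow> J \<in> indep M"
  using M by (auto simp: is_matroid_def)

lemma indep_augment:
  assumes "I \<in> indep M" "J \<in> indep M" "card I < card J"
  obtains x where "x \<in> J - I" "insert x I \<in> indep M"
proof -
  have "\<exists>x\<in>J - I. insert x I \<in> indep M"
    using M assms by (simp add: is_matroid_def)
  then show thesis using that by blast
qed

lemma finite_indep_subsets: "finite {I \<in> indep M. I \<subseteq> A}"
  using indep_subset_ground finite_ground by (auto intro: finite_subset[of _ "Pow (ground M)"])

lemma card_le_rank_of:
  assumes "I \<in> indep M" "I \<subseteq> A"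
  shows "card I \<le> rank_of M A"
  unfolding rank_of_def using assms finite_indep_subsets by (intro Max_ge) auto

lemma obtain_basis:
  obtains B where "is_basis M A B"
proof -
  have "rank_of M A \<in> card ` {I \<in> indep M. I \<subseteq> A}"
    unfolding rank_of_def using finite_indep_subsets empty_indep by (intro Max_in) auto
  then show thesis using that by (auto simp: is_basis_def)
qed

lemma indep_extends_to_basis:
  assumes "I \<in> indep M" "I \<subseteq> A"
  obtains B where "is_basis M A B" "I \<subseteq> B"
proof -
  have "\<exists>B. is_basis M A B \<and> I \<subseteq> B"
    using assms
  proof (induction "rank_of M A - card I" arbitrary: I rule: less_induct)
    case less
    obtain B where B: "is_basis M A B" by (rule obtain_basis)
    show ?case
    proof (cases "card I < card B")
      case True
      obtain x where x: "x \<in> B - I" "insert x I \<in> indep M"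
        using indep_augment[OF less.prems(1) is_basisD(1)[OF B] True] .
      have "card (insert x I) = Suc (card I)"
        using x finite_indep[OF less.prems(1)] by simp
      then have "\<exists>B. is_basis M A B \<and> insert x I \<subseteq> B"
        using True x less.prems is_basisD(2,3)[OF B] by (intro less.hyps) auto
      then show ?thesis by auto
    next
      case False
      then have "card I = rank_of M A"
        using is_basisD(3)[OF B] card_le_rank_of[OF less.prems] by simp
      then show ?thesis using less.prems by (auto simp: is_basis_def)
    qed
  qed
  then show thesis using that by blast
qed

lemma rank_of_mono:
  assumes "A \<subseteq> B"
  shows "rank_of M A \<le> rank_of M B"
  using obtain_basis[of A] assms by (metis is_basis_def card_le_rank_of order_trans)

lemma rank_of_le_rk: "A \<subseteq> ground M \<Longrightarrow> rank_of M A \<le> rk M"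
  unfolding rk_def by (rule rank_of_mono)

lemma rank_of_le_card:
  assumes "finite A"
  shows "rank_of M A \<le> card A"
  using obtain_basis[of A] assms by (metis is_basis_def card_mono)

lemma rank_of_empty: "rank_of M {} = 0"
  using rank_of_le_card[of "{}"] by simp

lemma rank_of_Un_le:
  assumes "finite I"
  shows "rank_of M (I \<union> F) \<le> card I + rank_of M F"
proof -
  obtain C where C: "is_basis M (I \<union> F) C" by (rule obtain_basis)
  have "card C \<le> card (C \<inter> I) + card (C \<inter> F)"
    using is_basisD(2)[OF C] card_Un_le[of "C \<inter> I" "C \<inter> F"]
    by (simp add: Int_Un_distrib[symmetric] Int_absorb2)
  also have "card (C \<inter> I) \<le> card I" using assms by (simp add: card_mono)
  also have "card (C \<inter> F) \<le> rank_of M F"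
    using indep_subset is_basisD(1)[OF C] by (intro card_le_rank_of) auto
  finally show ?thesis using is_basisD(3)[OF C] by simp
qed

lemma basis_Un_indep_Int:
  assumes B: "is_basis M F B" and C: "C \<in> indep M" "B \<subseteq> C"
  shows "C \<inter> F = B"
proof -
  have "C \<inter> F \<in> indep M" using indep_subset C(1) by auto
  then have "card (C \<inter> F) \<le> card B" "finite (C \<inter> F)"
    using card_le_rank_of finite_indep is_basisD(3)[OF B] by auto
  then show ?thesis using is_basisD(2)[OF B] C(2) card_seteq[of "C \<inter> F" B] by auto
qed

lemma Un_basis_indep:
  assumes B: "is_basis M F B" and I: "finite I" "card I + rank_of M F \<le> rank_of M (I \<union> F)"
  shows "I \<union> B \<in> indep M"
proof -
  obtain C where C: "is_basis M (I \<union> F) C" "B \<subseteq> C"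
    using indep_extends_to_basis[of B "I \<union> F"] is_basisD[OF B] by auto
  have "C \<inter> F = B" using basis_Un_indep_Int[OF B is_basisD(1)[OF C(1)] C(2)] .
  then have "C - B \<subseteq> I" using is_basisD(2)[OF C(1)] by auto
  moreover have "card I \<le> card (C - B)"
    using I(2) C(2) finite_indep[OF is_basisD(1)[OF B]] is_basisD(3)[OF B] is_basisD(3)[OF C(1)]
    by (simp add: card_Diff_subset)
  ultimately have "C - B = I" using I(1) by (intro card_seteq) auto
  then have "C = I \<union> B" using C(2) by auto
  then show ?thesis using is_basisD(1)[OF C(1)] by simp
qed

end

section \<open>Contraction and restriction\<close>

lemma ground_contraction [simp]: "ground (contraction M F) = ground M - F"
  by (simp add: contraction_def)

lemma ground_restriction [simp]: "ground (restriction M F) = F"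
  by (simp add: restriction_def)

context
  fixes M :: "'a matroid"
  assumes M: "is_matroid M"
begin

lemma indep_contraction_iff_rank:
  "I \<in> indep (contraction M F) \<longleftrightarrow>
    I \<subseteq> ground M - F \<and> rank_of M (I \<union> F) = card I + rank_of M F"
proof
  assume "I \<in> indep (contraction M F)"
  then obtain B where I: "I \<subseteq> ground M - F" and B: "is_basis M F B" "I \<union> B \<in> indep M"
    by (auto simp: contraction_def is_basis_def)
  have fin: "finite I" "finite B" using finite_indep[OF M B(2)] by auto
  have "card I + rank_of M F = card (I \<union> B)"
    using fin I is_basisD(2,3)[OF B(1)] by (subst card_Un_disjoint) auto
  also have "\<dots> \<le> rank_of M (I \<union> F)"
    using B is_basisD(2)[OF B(1)] by (intro card_le_rank_of[OF M]) auto
  finally show "I \<subseteq> ground M - F \<and> rank_of M (I \<union> F) = card I + rank_of M F"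
    using rank_of_Un_le[OF M fin(1), of F] I by simp
next
  assume I: "I \<subseteq> ground M - F \<and> rank_of M (I \<union> F) = card I + rank_of M F"
  obtain B where B: "is_basis M F B" using obtain_basis[OF M] .
  have "I \<union> B \<in> indep M"
    using I finite_ground[OF M] by (intro Un_basis_indep[OF M B]) (auto intro: finite_subset)
  then show "I \<in> indep (contraction M F)"
    using I B by (auto simp: contraction_def is_basis_def)
qed

lemma indep_contraction_iff_basis:
  assumes B: "is_basis M F B"
  shows "I \<in> indep (contraction M F) \<longleftrightarrow> I \<subseteq> ground M - F \<and> I \<union> B \<in> indep M"
proof
  assume "I \<in> indep (contraction M F)"
  then show "I \<subseteq> ground M - F \<and> I \<union> B \<in> indep M"
    using finite_subset[OF _ finite_ground[OF M]]
    by (auto simp: indep_contraction_iff_rank intro!: Un_basis_indep[OF M B])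
qed (use B in \<open>auto simp: contraction_def is_basis_def\<close>)

lemma is_matroid_contraction: "is_matroid (contraction M F)"
proof -
  obtain B where B: "is_basis M F B" using obtain_basis[OF M] .
  note indep = indep_contraction_iff_basis[OF B]
  have card_Un: "card (I \<union> B) = card I + card B" if "I \<in> indep (contraction M F)" for I
    using that is_basisD(2)[OF B] finite_indep[OF M, of "I \<union> B"]
    by (intro card_Un_disjoint) (auto simp: indep)
  show ?thesis
    unfolding is_matroid_def
  proof (intro conjI ballI allI impI)
    show "finite (ground (contraction M F))" using finite_ground[OF M] by simp
    show "indep (contraction M F) \<subseteq> Pow (ground (contraction M F))" using indep by auto
    show "{} \<in> indep (contraction M F)" using indep is_basisD(1)[OF B] by auto
    show "J \<in> indep (contraction M F)" if "I \<in> indep (contraction M F)" "J \<subseteq> I" for I J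
      using that indep_subset[OF M, of "I \<union> B" "J \<union> B"] unfolding indep by auto
    show "\<exists>x\<in>J - I. insert x I \<in> indep (contraction M F)"
      if "I \<in> indep (contraction M F)" "J \<in> indep (contraction M F)" "card I < card J" for I J
    proof -
      have "I \<union> B \<in> indep M" "J \<union> B \<in> indep M" "card (I \<union> B) < card (J \<union> B)"
        using that card_Un by (auto simp: indep)
      then obtain x where "x \<in> (J \<union> B) - (I \<union> B)" "insert x (I \<union> B) \<in> indep M"
        by (rule indep_augment[OF M])
      then show ?thesis using that unfolding indep by auto
    qed
  qed
qed

lemma contraction_empty: "contraction M {} = M"
proof -
  have "is_basis M {} {}" by (simp add: is_basis_def empty_indep[OF M] rank_of_empty[OF M])
  then show ?thesis
    using indep_subset_ground[OF M]
    by (intro matroid.expand) (auto simp: indep_contraction_iff_basis)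
qed

lemma rank_of_contraction:
  assumes A: "A \<subseteq> ground M - F"
  shows "rank_of (contraction M F) A = rank_of M (A \<union> F) - rank_of M F"
proof (rule antisym)
  obtain I where I: "is_basis (contraction M F) A I"
    using obtain_basis[OF is_matroid_contraction] .
  have "card I = rank_of M (I \<union> F) - rank_of M F"
    using is_basisD(1)[OF I] by (simp add: indep_contraction_iff_rank)
  also have "\<dots> \<le> rank_of M (A \<union> F) - rank_of M F"
    using is_basisD(2)[OF I] by (intro diff_le_mono rank_of_mono[OF M]) auto
  finally show "rank_of (contraction M F) A \<le> rank_of M (A \<union> F) - rank_of M F"
    using is_basisD(3)[OF I] by simp
next
  obtain B where B: "is_basis M F B" using obtain_basis[OF M] .
  obtain C where C: "is_basis M (A \<union> F) C" "B \<subseteq> C"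
    using indep_extends_to_basis[OF M, of B "A \<union> F"] is_basisD[OF B] by auto
  have CF: "C \<inter> F = B" using basis_Un_indep_Int[OF M B is_basisD(1)[OF C(1)] C(2)] .
  have "C - B \<union> B = C" using C(2) by auto
  then have "C - B \<in> indep (contraction M F)"
    using A is_basisD(1,2)[OF C(1)] CF by (auto simp: indep_contraction_iff_basis[OF B])
  then have "card (C - B) \<le> rank_of (contraction M F) A"
    using is_basisD(2)[OF C(1)] CF by (intro card_le_rank_of is_matroid_contraction) auto
  then show "rank_of M (A \<union> F) - rank_of M F \<le> rank_of (contraction M F) A"
    using C(2) is_basisD(3)[OF B] is_basisD(3)[OF C(1)] finite_indep[OF M is_basisD(1)[OF B]]
    by (simp add: card_Diff_subset)
qed

lemma rank_of_contraction_Diff: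
  assumes "F \<subseteq> G" "G \<subseteq> ground M"
  shows "rank_of (contraction M F) (G - F) = rank_of M G - rank_of M F"
  using assms by (subst rank_of_contraction) (auto simp: Un_absorb2)

lemma rk_contraction: "F \<subseteq> ground M \<Longrightarrow> rk (contraction M F) = rk M - rank_of M F"
  by (simp add: rk_def rank_of_contraction_Diff)

end

lemma contraction_contraction:
  assumes M: "is_matroid M" and FG: "F \<subseteq> G" "G \<subseteq> ground M"
  shows "contraction (contraction M F) (G - F) = contraction M G"
proof -
  have "I \<in> indep (contraction (contraction M F) (G - F)) \<longleftrightarrow> I \<in> indep (contraction M G)"
    if I: "I \<subseteq> ground M - G" for I
  proof -
    have "I \<union> (G - F) = I \<union> G - F" using I FG by auto
    then have "rank_of (contraction M F) (I \<union> (G - F)) = rank_of M (I \<union> G) - rank_of M F"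
      using rank_of_contraction_Diff[OF M, of F "I \<union> G"] I FG by auto
    moreover have "rank_of M F \<le> rank_of M G" "rank_of M G \<le> rank_of M (I \<union> G)"
      using FG by (auto intro: rank_of_mono[OF M])
    ultimately show ?thesis
      using I FG
      by (auto simp: indep_contraction_iff_rank is_matroid_contraction M rank_of_contraction_Diff)
  qed
  moreover have "I \<subseteq> ground M - G"
    if "I \<in> indep (contraction (contraction M F) (G - F)) \<or> I \<in> indep (contraction M G)" for I
    using that FG by (auto simp: indep_contraction_iff_rank is_matroid_contraction M)
  ultimately have "indep (contraction (contraction M F) (G - F)) = indep (contraction M G)" by blast
  moreover have "ground M - F - (G - F) = ground M - G" using FG by blast
  ultimately show ?thesis by (intro matroid.expand) simp
qed

lemma rank_of_restriction: "A \<subseteq> F \<Longrightarrow> rank_of (restriction M F) A = rank_of M A"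
  unfolding rank_of_def restriction_def
  by (auto intro!: arg_cong[of _ _ Max] arg_cong[of _ _ "image card"])

lemma rk_restriction: "rk (restriction M F) = rank_of M F"
  by (simp add: rk_def rank_of_restriction)

section \<open>Flats of minors\<close>

lemma inj_on_Diff:
  fixes A :: "'a set set"
  assumes "A \<subseteq> {F..}"
  shows "inj_on (\<lambda>G. G - F) A"
  using assms by (intro inj_on_inverseI[of _ "\<lambda>G. G \<union> F"]) auto

lemma flats_subset: "F \<in> flats M \<Longrightarrow> F \<subseteq> ground M"
  by (simp add: flats_def)

lemma ground_in_flats: "ground M \<in> flats M"
  by (simp add: flats_def)

lemma rank_of_flat_less_insert:
  "F \<in> flats M \<Longrightarrow> x \<in> ground M - F \<Longrightarrow> rank_of M F < rank_of M (insert x F)"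
  by (simp add: flats_def)

context
  fixes M :: "'a matroid"
  assumes M: "is_matroid M"
begin

lemma finite_flats: "finite (flats M)"
  using finite_ground[OF M] flats_subset by (auto intro: finite_subset[of _ "Pow (ground M)"])

lemma empty_in_flats: "loopless M \<Longrightarrow> {} \<in> flats M"
  using card_le_rank_of[OF M] by (fastforce simp: flats_def loopless_def rank_of_empty[OF M])

lemma rank_of_flat_less_rk:
  assumes "F \<in> flats M" "F \<noteq> ground M"
  shows "rank_of M F < rk M"
proof -
  obtain x where x: "x \<in> ground M - F" using assms flats_subset by blast
  then have "rank_of M F < rank_of M (insert x F)" by (rule rank_of_flat_less_insert[OF assms(1)])
  also have "\<dots> \<le> rk M" using x flats_subset[OF assms(1)] by (intro rank_of_le_rk[OF M]) auto
  finally show ?thesis .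
qed

lemma rank_of_insert_less_of_subset_flat:
  assumes F: "F \<in> flats M" "x \<in> ground M - F" and "G \<subseteq> F"
  shows "rank_of M G < rank_of M (insert x G)"
proof -
  obtain B where B: "is_basis M G B" using obtain_basis[OF M] .
  obtain C where C: "is_basis M F C" "B \<subseteq> C"
    using indep_extends_to_basis[OF M is_basisD(1)[OF B], of F] is_basisD(2)[OF B] assms(3) by auto
  obtain D where D: "is_basis M (insert x F) D" "C \<subseteq> D"
    using indep_extends_to_basis[OF M is_basisD(1)[OF C(1)], of "insert x F"] is_basisD(2)[OF C(1)]
    by auto
  have "\<not> D \<subseteq> F"
    using rank_of_flat_less_insert[OF F] is_basisD[OF D(1)] card_le_rank_of[OF M, of D F] by auto
  then have "insert x B \<subseteq> D" using is_basisD(2)[OF D(1)] C(2) D(2) by blast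
  then have "insert x B \<in> indep M" by (rule indep_subset[OF M is_basisD(1)[OF D(1)]])
  then have "card (insert x B) \<le> rank_of M (insert x G)"
    using is_basisD(2)[OF B] by (intro card_le_rank_of[OF M]) auto
  moreover have "x \<notin> B" using is_basisD(2)[OF B] assms by auto
  ultimately show ?thesis
    using is_basisD(3)[OF B] finite_indep[OF M is_basisD(1)[OF B]] by simp
qed

lemma flats_restriction:
  assumes F: "F \<in> flats M"
  shows "flats (restriction M F) = flats M \<inter> {..F}"
proof -
  have "rank_of M G < rank_of M (insert x G)"
    if "G \<in> flats (restriction M F)" "x \<in> ground M - G" for x G
  proof (cases "x \<in> F")
    case True
    then show ?thesis using that by (auto simp: flats_def rank_of_restriction)
  next
    case False
    then show ?thesis
      using that flats_subset[OF that(1)] by (intro rank_of_insert_less_of_subset_flat[OF F]) auto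
  qed
  then show ?thesis
    using flats_subset[OF F] by (auto simp: flats_def rank_of_restriction)
qed

lemma mem_flats_contraction_iff:
  assumes F: "F \<subseteq> ground M"
  shows "H \<in> flats (contraction M F) \<longleftrightarrow> H \<subseteq> ground M - F \<and> H \<union> F \<in> flats M"
proof -
  have "rank_of (contraction M F) H < rank_of (contraction M F) (insert x H) \<longleftrightarrow>
      rank_of M (H \<union> F) < rank_of M (insert x (H \<union> F))"
    if "H \<subseteq> ground M - F" "x \<in> ground M - (H \<union> F)" for x
    using that rank_of_mono[OF M, of F "H \<union> F"] rank_of_mono[OF M, of F "insert x (H \<union> F)"]
    by (simp add: rank_of_contraction[OF M]) linarith
  moreover have "ground M - F - H = ground M - (H \<union> F)" by auto
  ultimately show ?thesis using F unfolding flats_def by auto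
qed

lemma flats_contraction:
  assumes F: "F \<subseteq> ground M"
  shows "flats (contraction M F) = (\<lambda>G. G - F) ` (flats M \<inter> {F..})"
proof (intro set_eqI iffI)
  fix H assume "H \<in> flats (contraction M F)"
  then have "H \<union> F \<in> flats M \<inter> {F..}" "H = H \<union> F - F"
    using mem_flats_contraction_iff[OF F] by auto
  then show "H \<in> (\<lambda>G. G - F) ` (flats M \<inter> {F..})" by blast
next
  fix H assume "H \<in> (\<lambda>G. G - F) ` (flats M \<inter> {F..})"
  then show "H \<in> flats (contraction M F)"
    using flats_subset by (fastforce simp: mem_flats_contraction_iff[OF F] Un_absorb2)
qed

lemma loopless_contraction:
  assumes F: "F \<in> flats M"
  shows "loopless (contraction M F)"
  unfolding loopless_def
proof
  fix x assume x: "x \<in> ground (contraction M F)"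
  then have "rank_of M F < rank_of M (insert x F)" using rank_of_flat_less_insert[OF F] by simp
  then show "{x} \<in> indep (contraction M F)"
    using rank_of_Un_le[OF M, of "{x}" F] x by (auto simp: indep_contraction_iff_rank[OF M])
qed

lemma card_ground_contraction_less:
  assumes "F \<in> flats M" "F \<noteq> {}"
  shows "card (ground (contraction M F)) < card (ground M)"
  using assms flats_subset[of F M] finite_ground[OF M] by (auto intro!: psubset_card_mono)

end

lemma loopless_matroid_induct [consumes 2, case_names contraction]:
  assumes "is_matroid M" "loopless M"
    and contraction: "\<And>M. is_matroid M \<Longrightarrow> loopless M \<Longrightarrow>
      (\<And>F. F \<in> flats M \<Longrightarrow> F \<noteq> {} \<Longrightarrow> P (contraction M F)) \<Longrightarrow> P M"
  shows "P M"
  using assms(1,2)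
proof (induction "card (ground M)" arbitrary: M rule: less_induct)
  case less
  show ?case
  proof (rule contraction[OF less.prems])
    fix F assume F: "F \<in> flats M" "F \<noteq> {}"
    show "P (contraction M F)"
      using F less.prems(1)
      by (intro less.hyps card_ground_contraction_less is_matroid_contraction loopless_contraction)
  qed
qed

definition minor :: "'a matroid \<Rightarrow> 'a set \<Rightarrow> 'a set \<Rightarrow> 'a matroid" where
  "minor M F G = restriction (contraction M F) (G - F)"

context
  fixes M :: "'a matroid" and F G :: "'a set"
  assumes M: "is_matroid M" and F: "F \<in> flats M" and G: "G \<in> flats M" and FG: "F \<subseteq> G"
begin

lemma flats_minor: "flats (minor M F G) = (\<lambda>K. K - F) ` (flats M \<inter> {F..G})"
proof -
  have "G - F \<in> flats (contraction M F)"
    using G FG flats_subset[OF F] by (auto simp: flats_contraction[OF M])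
  then have "flats (minor M F G) = flats (contraction M F) \<inter> {..G - F}"
    unfolding minor_def by (intro flats_restriction is_matroid_contraction M)
  also have "\<dots> = (\<lambda>K. K - F) ` (flats M \<inter> {F..G})"
  proof -
    have "flats M \<inter> {F..G} = {K \<in> flats M \<inter> {F..}. K - F \<in> {..G - F}}"
      using FG by (auto simp: Diff_subset_conv Un_absorb1)
    then show ?thesis unfolding flats_contraction[OF M flats_subset[OF F]] by blast
  qed
  finally show ?thesis .
qed

lemma rank_of_minor:
  assumes "F \<subseteq> K" "K \<subseteq> G"
  shows "rank_of (minor M F G) (K - F) = rank_of M K - rank_of M F"
proof -
  have "rank_of (minor M F G) (K - F) = rank_of (contraction M F) (K - F)"
    unfolding minor_def using assms by (intro rank_of_restriction) auto
  also have "\<dots> = rank_of M K - rank_of M F"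
    using assms flats_subset[OF G] by (intro rank_of_contraction_Diff[OF M]) auto
  finally show ?thesis .
qed

lemma rk_minor: "rk (minor M F G) = rank_of M G - rank_of M F"
  using rank_of_minor[of G] FG by (simp add: rk_def minor_def)

end

section \<open>Moebius inversion\<close>

lemma sum_swap_le:
  fixes f :: "'a::preorder \<Rightarrow> 'a \<Rightarrow> 'b::comm_monoid_add"
  assumes "finite A"
  shows "(\<Sum>x\<in>A. \<Sum>y\<in>A \<inter> {x..}. f x y) = (\<Sum>y\<in>A. \<Sum>x\<in>A \<inter> {..y}. f x y)"
proof -
  have "A \<inter> {x..} = {y \<in> A. x \<le> y}" "A \<inter> {..x} = {y \<in> A. y \<le> x}" for x by auto
  then show ?thesis using sum.swap_restrict[OF assms assms, of f "(\<le>)"] by simp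
qed

lemma moebius_refl [simp]: "moebius L X X = 1"
  by (simp add: moebius.simps)

lemma moebius_psubset:
  assumes "finite L" "X \<subset> Y"
  shows "moebius L X Y = - (\<Sum>Z\<in>L \<inter> {X..<Y}. moebius L X Z)"
proof -
  have "{Z \<in> L. X \<subseteq> Z \<and> Z \<subset> Y} = L \<inter> {X..<Y}" by auto
  then show ?thesis using assms by (subst moebius.simps) auto
qed

lemma moebius_not_subset: "\<not> X \<subseteq> Y \<Longrightarrow> moebius L X Y = 0"
  by (subst moebius.simps) auto

lemma sum_moebius_lower:
  assumes "finite L" "X \<in> L" "Y \<in> L" "X \<subseteq> Y"
  shows "(\<Sum>Z\<in>L \<inter> {X..Y}. moebius L Z Y) = (if X = Y then 1 else 0)"
  using assms
proof (induction L X Y rule: moebius.induct [case_names recursion])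
  case (recursion L X Y)
  show ?case
  proof (cases "X = Y")
    case True
    then have "L \<inter> {X..Y} = {Y}" using recursion.prems by auto
    then show ?thesis using True by simp
  next
    case False
    let ?I = "L \<inter> {X..<Y}"
    have fin: "finite ?I" using recursion.prems by simp
    have lower: "(\<Sum>Z\<in>?I \<inter> {..W}. moebius L Z W) = (if X = W then 1 else 0)" if W: "W \<in> ?I" for W
    proof -
      have "?I \<inter> {..W} = L \<inter> {X..W}" using W by fastforce
      then show ?thesis using recursion.IH[of W] False W recursion.prems by auto
    qed
    have "(\<Sum>Z\<in>?I. moebius L Z Y) = (\<Sum>Z\<in>?I. - (\<Sum>W\<in>?I \<inter> {Z..}. moebius L Z W))"
    proof (intro sum.cong refl)
      fix Z assume Z: "Z \<in> ?I"
      then have "L \<inter> {Z..<Y} = ?I \<inter> {Z..}" by fastforce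
      then show "moebius L Z Y = - (\<Sum>W\<in>?I \<inter> {Z..}. moebius L Z W)"
        using Z recursion.prems(1) by (simp add: moebius_psubset)
    qed
    also have "\<dots> = - (\<Sum>W\<in>?I. \<Sum>Z\<in>?I \<inter> {..W}. moebius L Z W)"
      by (simp add: sum_negf sum_swap_le[OF fin])
    also have "\<dots> = - (\<Sum>W\<in>?I. if X = W then 1 else 0)"
      using lower by simp
    also have "\<dots> = - 1" using False recursion.prems fin by simp
    finally have "(\<Sum>Z\<in>?I. moebius L Z Y) = - 1" .
    moreover have "L \<inter> {X..Y} = insert Y ?I" using recursion.prems by auto
    ultimately show ?thesis using False fin by simp
  qed
qed

lemma moebius_interval:
  assumes "finite L" "Z \<subseteq> Y"
  shows "moebius (L \<inter> {X..Y}) X Z = moebius L X Z"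
  using assms
proof (induction L X Z rule: moebius.induct [case_names recursion])
  case (recursion L X Z)
  show ?case
  proof (cases "X \<subset> Z")
    case True
    have "moebius (L \<inter> {X..Y}) X Z = - (\<Sum>W\<in>L \<inter> {X..Y} \<inter> {X..<Z}. moebius (L \<inter> {X..Y}) X W)"
      using True recursion.prems by (intro moebius_psubset) auto
    also have "L \<inter> {X..Y} \<inter> {X..<Z} = L \<inter> {X..<Z}" using recursion.prems by fastforce
    also have "(\<Sum>W\<in>L \<inter> {X..<Z}. moebius (L \<inter> {X..Y}) X W) = (\<Sum>W\<in>L \<inter> {X..<Z}. moebius L X W)"
      using True recursion.prems by (intro sum.cong refl recursion.IH) auto
    finally show ?thesis using True recursion.prems by (simp add: moebius_psubset)
  next
    case False
    then show ?thesis by (cases "X = Z") (auto simp: moebius_not_subset)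
  qed
qed

lemma moebius_image:
  fixes f :: "'a set \<Rightarrow> 'b set"
  assumes "finite L" "X \<in> L" "Y \<in> L"
    and embed: "\<And>Z W. Z \<in> L \<Longrightarrow> W \<in> L \<Longrightarrow> f Z \<subseteq> f W \<longleftrightarrow> Z \<subseteq> W"
  shows "moebius (f ` L) (f X) (f Y) = moebius L X Y"
  using assms
proof (induction L X Y rule: moebius.induct [case_names recursion])
  case (recursion L X Y)
  have embed_eq: "f Z = f W \<longleftrightarrow> Z = W" if "Z \<in> L" "W \<in> L" for Z W
    using recursion.prems(4) that by (metis subset_antisym order_refl)
  show ?case
  proof (cases "X \<subset> Y")
    case True
    have "f X \<subset> f Y" using True recursion.prems embed_eq by (metis psubsetE psubsetI order_refl)
    then have "moebius (f ` L) (f X) (f Y) = - (\<Sum>Z\<in>f ` L \<inter> {f X..<f Y}. moebius (f ` L) (f X) Z)"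
      using recursion.prems(1) by (intro moebius_psubset) auto
    also have "f ` L \<inter> {f X..<f Y} = f ` (L \<inter> {X..<Y})"
      using recursion.prems(2-4) by (auto simp: less_le_not_le)
    also have "(\<Sum>Z\<in>f ` (L \<inter> {X..<Y}). moebius (f ` L) (f X) Z) =
        (\<Sum>Z\<in>L \<inter> {X..<Y}. moebius (f ` L) (f X) (f Z))"
      using embed_eq by (subst sum.reindex) (auto simp: inj_on_def)
    also have "\<dots> = (\<Sum>Z\<in>L \<inter> {X..<Y}. moebius L X Z)"
      using True recursion.prems by (intro sum.cong refl recursion.IH) auto
    finally show ?thesis using True recursion.prems(1) by (simp add: moebius_psubset)
  next
    case False
    then show ?thesis
      using recursion.prems by (cases "X = Y") (auto simp: moebius_not_subset)
  qed
qed

section \<open>Characteristic polynomials of minors\<close>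

lemma char_poly_minor:
  assumes M: "is_matroid M" and F: "F \<in> flats M" and G: "G \<in> flats M" and FG: "F \<subseteq> G"
  shows "char_poly (minor M F G) =
    (\<Sum>K\<in>flats M \<inter> {F..G}. monom (moebius (flats M) F K) (rank_of M G - rank_of M K))"
proof -
  let ?I = "flats M \<inter> {F..G}" and ?N = "minor M F G"
  note flats = flats_minor[OF assms] and rank = rank_of_minor[OF assms]
  have F_in: "F \<in> ?I" using F FG by simp
  then have "\<Inter>(flats ?N) = {}" unfolding flats by force
  then have "char_poly ?N = (\<Sum>H\<in>(\<lambda>K. K - F) ` ?I.
      monom (moebius ((\<lambda>K. K - F) ` ?I) {} H) (rk ?N - rank_of ?N H))"
    unfolding char_poly_def by (simp add: flats)
  also have "\<dots> = (\<Sum>K\<in>?I. monom (moebius ((\<lambda>K. K - F) ` ?I) {} (K - F)) (rk ?N - rank_of ?N (K - F)))"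
    by (subst sum.reindex[OF inj_on_Diff]) auto
  also have "\<dots> = (\<Sum>K\<in>?I. monom (moebius (flats M) F K) (rank_of M G - rank_of M K))"
  proof (intro sum.cong refl)
    fix K assume K: "K \<in> ?I"
    have "moebius ((\<lambda>K. K - F) ` ?I) (F - F) (K - F) = moebius ?I F K"
      using K F_in finite_flats[OF M] by (intro moebius_image) auto
    also have "\<dots> = moebius (flats M) F K"
      using K by (intro moebius_interval finite_flats[OF M]) auto
    finally show "monom (moebius ((\<lambda>K. K - F) ` ?I) {} (K - F)) (rk ?N - rank_of ?N (K - F)) =
        monom (moebius (flats M) F K) (rank_of M G - rank_of M K)"
      using K rank_of_mono[OF M, of F K] rank[of K] by (simp add: rk_minor[OF assms])
  qed
  finally show ?thesis .
qed

lemma sum_char_poly_minor: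
  assumes M: "is_matroid M" "loopless M" and G: "G \<in> flats M"
  shows "(\<Sum>F\<in>flats M \<inter> {..G}. char_poly (minor M F G)) = monom 1 (rank_of M G)"
proof -
  let ?D = "flats M \<inter> {..G}" and ?r = "rank_of M" and ?mu = "moebius (flats M)"
  have fin: "finite ?D" using finite_flats[OF M(1)] by auto
  have "(\<Sum>F\<in>?D. char_poly (minor M F G)) = (\<Sum>F\<in>?D. \<Sum>K\<in>?D \<inter> {F..}. monom (?mu F K) (?r G - ?r K))"
  proof (intro sum.cong refl)
    fix F assume "F \<in> ?D"
    moreover have "?D \<inter> {F..} = flats M \<inter> {F..G}" by auto
    ultimately show "char_poly (minor M F G) = (\<Sum>K\<in>?D \<inter> {F..}. monom (?mu F K) (?r G - ?r K))"
      using G by (simp add: char_poly_minor[OF M(1)])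
  qed
  also have "\<dots> = (\<Sum>K\<in>?D. \<Sum>F\<in>?D \<inter> {..K}. monom (?mu F K) (?r G - ?r K))"
    by (rule sum_swap_le[OF fin])
  also have "\<dots> = (\<Sum>K\<in>?D. if K = {} then monom 1 (?r G) else 0)"
  proof (intro sum.cong refl)
    fix K assume K: "K \<in> ?D"
    have "?D \<inter> {..K} = flats M \<inter> {{}..K}" using K by fastforce
    then have "(\<Sum>F\<in>?D \<inter> {..K}. ?mu F K) = (if {} = K then 1 else 0)"
      using K empty_in_flats[OF M] by (simp add: sum_moebius_lower finite_flats[OF M(1)])
    then show "(\<Sum>F\<in>?D \<inter> {..K}. monom (?mu F K) (?r G - ?r K)) = (if K = {} then monom 1 (?r G) else 0)"
      by (auto simp: monom_sum[symmetric] rank_of_empty[OF M(1)])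
  qed
  also have "\<dots> = monom 1 (?r G)"
    using fin empty_in_flats[OF M] by simp
  finally show ?thesis .
qed

section \<open>Palindromic polynomials\<close>

lemma coeff_rev_poly:
  assumes "degree p \<le> n"
  shows "coeff (rev_poly n p) i = (if i \<le> n then coeff p (n - i) else 0)"
  using assms
  by (auto simp: rev_poly_def coeff_monom_mult coeff_reflect_poly coeff_eq_0 le_degree
      intro!: arg_cong[of _ _ "coeff p"])

lemma rev_poly_sum:
  assumes "finite A" "\<And>x. x \<in> A \<Longrightarrow> degree (f x) \<le> n"
  shows "rev_poly n (\<Sum>x\<in>A. f x) = (\<Sum>x\<in>A. rev_poly n (f x))"
  using assms degree_sum_le[OF assms]
  by (intro poly_eqI) (auto simp: coeff_rev_poly coeff_sum)

lemma rev_poly_monom_mult: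
  assumes "a \<le> n" "degree p \<le> n - a"
  shows "rev_poly n (monom 1 a * p) = rev_poly (n - a) p"
proof -
  have "degree (monom 1 a * p) \<le> n"
    using assms degree_mult_le[of "monom 1 a" p] by (simp add: degree_monom_eq)
  then show ?thesis
    using assms
    by (intro poly_eqI) (auto simp: coeff_rev_poly coeff_monom_mult coeff_eq_0 add.commute)
qed

definition palindromic_completion :: "nat \<Rightarrow> int poly \<Rightarrow> int poly" where
  "palindromic_completion n q = (\<Sum>i | 2 * i < n. monom (coeff q (n - i) - coeff q i) i)"

lemma coeff_palindromic_completion:
  "coeff (palindromic_completion n q) i = (if 2 * i < n then coeff q (n - i) - coeff q i else 0)"
proof -
  have "finite {i. 2 * i < n}" by (rule finite_subset[of _ "{..n}"]) auto
  then show ?thesis by (simp add: palindromic_completion_def coeff_sum)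
qed

lemma degree_palindromic_completion:
  assumes "n > 0"
  shows "2 * degree (palindromic_completion n q) < n"
proof -
  have "degree (palindromic_completion n q) \<le> (n - 1) div 2"
    using assms by (intro degree_le) (auto simp: coeff_palindromic_completion)
  then show ?thesis using assms by linarith
qed

lemma rev_poly_add_eq_iff:
  assumes "2 * degree p < n" "degree q \<le> n"
  shows "rev_poly n (p + q) = p + q \<longleftrightarrow> p = palindromic_completion n q"
proof -
  have deg: "degree (p + q) \<le> n" using assms by (intro degree_add_le) auto
  have high: "coeff p i = 0" if "n \<le> 2 * i" for i
    using assms(1) that by (intro coeff_eq_0) auto
  show ?thesis
  proof
    assume pal: "rev_poly n (p + q) = p + q"
    show "p = palindromic_completion n q"
    proof (rule poly_eqI)
      fix i
      have "coeff p (n - i) + coeff q (n - i) = coeff p i + coeff q i" if "i \<le> n"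
        using that arg_cong[OF pal, of "\<lambda>r. coeff r i"] by (simp add: coeff_rev_poly[OF deg])
      then show "coeff p i = coeff (palindromic_completion n q) i"
        using high[of i] high[of "n - i"] by (auto simp: coeff_palindromic_completion)
    qed
  next
    assume p: "p = palindromic_completion n q"
    have "coeff (p + q) (n - i) = coeff (p + q) i" if "i \<le> n" for i
    proof -
      consider (low) "2 * i < n" | (high) "n < 2 * i" | (middle) "n = 2 * i" by linarith
      then show ?thesis using that by cases (auto simp: p coeff_palindromic_completion)
    qed
    then show "rev_poly n (p + q) = p + q"
      using deg by (intro poly_eqI) (simp add: coeff_rev_poly coeff_eq_0 del: coeff_add)
  qed
qed

section \<open>Existence and uniqueness of Kazhdan--Lusztig polynomials\<close>

definition KL_sum :: "('a matroid \<Rightarrow> int poly) \<Rightarrow> 'a matroid \<Rightarrow> 'a set \<Rightarrow> int poly" where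
  "KL_sum P M F = (\<Sum>G\<in>flats M \<inter> {F..}. char_poly (minor M F G) * P (contraction M G))"

definition KL_equation :: "('a matroid \<Rightarrow> int poly) \<Rightarrow> 'a matroid \<Rightarrow> bool" where
  "KL_equation P M \<longleftrightarrow> rev_poly (rk M) (P M) = KL_sum P M {}"

definition KL_normalized :: "nat \<Rightarrow> int poly \<Rightarrow> bool" where
  "KL_normalized n p \<longleftrightarrow> (n = 0 \<longrightarrow> p = 1) \<and> (n > 0 \<longrightarrow> 2 * degree p < n)"

definition Z_tail :: "('a matroid \<Rightarrow> int poly) \<Rightarrow> 'a matroid \<Rightarrow> int poly" where
  "Z_tail P M = (\<Sum>F\<in>flats M - {{}}. monom 1 (rank_of M F) * P (contraction M F))"

definition Z_sum :: "('a matroid \<Rightarrow> int poly) \<Rightarrow> 'a matroid \<Rightarrow> int poly" where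
  "Z_sum P M = (\<Sum>F\<in>flats M. monom 1 (rank_of M F) * P (contraction M F))"

abbreviation Z_palindromic :: "('a matroid \<Rightarrow> int poly) \<Rightarrow> 'a matroid \<Rightarrow> bool" where
  "Z_palindromic P M \<equiv> rev_poly (rk M) (Z_sum P M) = Z_sum P M"

lemma Z_poly_eq_Z_sum: "Z_poly M = Z_sum KL_poly M"
  by (simp add: Z_poly_def Z_sum_def rk_restriction)

lemma KL_normalized_degree_le: "KL_normalized n p \<Longrightarrow> degree p \<le> n"
  by (cases "n = 0") (auto simp: KL_normalized_def)

lemma KL_assignment_iff_KL_equation:
  "KL_assignment P \<longleftrightarrow>
    (\<forall>M. is_matroid M \<and> loopless M \<longrightarrow> KL_normalized (rk M) (P M) \<and> KL_equation P M)"
proof -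
  have "flats M \<inter> {{}..} = flats M" for M :: "'a matroid" by auto
  then show ?thesis
    by (auto simp: KL_assignment_def KL_normalized_def KL_equation_def KL_sum_def minor_def
        contraction_empty)
qed

lemma KL_equation_contraction_iff:
  assumes M: "is_matroid M" and F: "F \<in> flats M"
  shows "KL_equation P (contraction M F) \<longleftrightarrow>
    rev_poly (rk (contraction M F)) (P (contraction M F)) = KL_sum P M F"
proof -
  have "KL_sum P (contraction M F) {} = (\<Sum>H\<in>flats (contraction M F).
      char_poly (restriction (contraction M F) H) * P (contraction (contraction M F) H))"
    unfolding KL_sum_def minor_def contraction_empty[OF is_matroid_contraction[OF M]]
    by (intro sum.cong) auto
  also have "\<dots> = (\<Sum>G\<in>flats M \<inter> {F..}.
      char_poly (minor M F G) * P (contraction (contraction M F) (G - F)))"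
    unfolding flats_contraction[OF M flats_subset[OF F]] minor_def
    by (subst sum.reindex[OF inj_on_Diff]) auto
  also have "\<dots> = KL_sum P M F"
    unfolding KL_sum_def
    by (intro sum.cong refl) (auto simp: contraction_contraction[OF M] dest: flats_subset)
  finally show ?thesis by (simp add: KL_equation_def)
qed

context
  fixes M :: "'a matroid"
  assumes M: "is_matroid M"
begin

lemma degree_Z_summand_le:
  fixes p :: "int poly"
  assumes F: "F \<in> flats M" and p: "degree p \<le> rk (contraction M F)"
  shows "degree (monom 1 (rank_of M F) * p) \<le> rk M"
  using degree_mult_le[of "monom 1 (rank_of M F)" p] p rk_contraction[OF M flats_subset[OF F]]
    rank_of_le_rk[OF M flats_subset[OF F]]
  by (simp add: degree_monom_eq)

lemma degree_Z_sum_le: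
  assumes "\<And>F. F \<in> flats M \<Longrightarrow> degree (P (contraction M F)) \<le> rk (contraction M F)"
  shows "degree (Z_sum P M) \<le> rk M"
  unfolding Z_sum_def using assms by (intro degree_sum_le finite_flats[OF M] degree_Z_summand_le)

lemma degree_Z_tail_le:
  assumes "\<And>F. F \<in> flats M \<Longrightarrow> F \<noteq> {} \<Longrightarrow> degree (P (contraction M F)) \<le> rk (contraction M F)"
  shows "degree (Z_tail P M) \<le> rk M"
  unfolding Z_tail_def using assms finite_flats[OF M]
  by (intro degree_sum_le degree_Z_summand_le) auto

lemma rev_poly_Z_sum:
  assumes deg: "\<And>F. F \<in> flats M \<Longrightarrow> degree (P (contraction M F)) \<le> rk (contraction M F)"
  shows "rev_poly (rk M) (Z_sum P M) =
    (\<Sum>F\<in>flats M. rev_poly (rk (contraction M F)) (P (contraction M F)))"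
proof -
  have "rev_poly (rk M) (Z_sum P M) =
      (\<Sum>F\<in>flats M. rev_poly (rk M) (monom 1 (rank_of M F) * P (contraction M F)))"
    unfolding Z_sum_def by (intro rev_poly_sum finite_flats[OF M] degree_Z_summand_le deg)
  also have "\<dots> = (\<Sum>F\<in>flats M. rev_poly (rk (contraction M F)) (P (contraction M F)))"
  proof (intro sum.cong refl)
    fix F assume F: "F \<in> flats M"
    note rk = rk_contraction[OF M flats_subset[OF F]]
    show "rev_poly (rk M) (monom 1 (rank_of M F) * P (contraction M F)) =
        rev_poly (rk (contraction M F)) (P (contraction M F))"
      using deg[OF F] unfolding rk
      by (intro rev_poly_monom_mult rank_of_le_rk[OF M flats_subset[OF F]])
  qed
  finally show ?thesis .
qed

context
  assumes loopless: "loopless M"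
begin

lemma sum_KL_sum: "(\<Sum>F\<in>flats M. KL_sum P M F) = Z_sum P M"
proof -
  have "(\<Sum>F\<in>flats M. KL_sum P M F) =
      (\<Sum>G\<in>flats M. \<Sum>F\<in>flats M \<inter> {..G}. char_poly (minor M F G) * P (contraction M G))"
    unfolding KL_sum_def by (rule sum_swap_le[OF finite_flats[OF M]])
  also have "\<dots> = Z_sum P M"
    unfolding Z_sum_def
    by (intro sum.cong refl)
      (simp add: sum_distrib_right[symmetric] sum_char_poly_minor[OF M loopless])
  finally show ?thesis .
qed

lemma KL_equation_iff_palindromic:
  assumes deg: "\<And>F. F \<in> flats M \<Longrightarrow> degree (P (contraction M F)) \<le> rk (contraction M F)"
    and KL: "\<And>F. F \<in> flats M \<Longrightarrow> F \<noteq> {} \<Longrightarrow> KL_equation P (contraction M F)"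
  shows "KL_equation P M \<longleftrightarrow> Z_palindromic P M"
proof -
  let ?defect = "\<lambda>F. rev_poly (rk (contraction M F)) (P (contraction M F)) - KL_sum P M F"
  have "rev_poly (rk M) (Z_sum P M) - Z_sum P M = (\<Sum>F\<in>flats M. ?defect F)"
    using rev_poly_Z_sum[OF deg] by (simp add: sum_subtractf sum_KL_sum)
  also have "\<dots> = ?defect {} + (\<Sum>F\<in>flats M - {{}}. ?defect F)"
    using finite_flats[OF M] empty_in_flats[OF M loopless] by (intro sum.remove)
  also have "(\<Sum>F\<in>flats M - {{}}. ?defect F) = 0"
    using KL by (intro sum.neutral) (auto simp: KL_equation_contraction_iff[OF M])
  finally show ?thesis
    by (auto simp: KL_equation_def contraction_empty[OF M])
qed

lemma Z_sum_eq_add_Z_tail: "Z_sum P M = P M + Z_tail P M"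
  unfolding Z_sum_def Z_tail_def
  by (subst sum.remove[OF finite_flats[OF M] empty_in_flats[OF M loopless]])
    (simp add: rank_of_empty[OF M] contraction_empty[OF M] monom_0)

lemma flats_rk_0:
  assumes "rk M = 0"
  shows "flats M = {{}}"
proof -
  have "ground M = {}"
    using rank_of_flat_less_rk[OF M empty_in_flats[OF M loopless]] assms by auto
  then show ?thesis using empty_in_flats[OF M loopless] flats_subset[of _ M] by auto
qed

end

end

lemma KL_assignment_iff_palindromic:
  "KL_assignment P \<longleftrightarrow> (\<forall>M. is_matroid M \<and> loopless M \<longrightarrow>
    KL_normalized (rk M) (P M) \<and> Z_palindromic P M)"
proof (cases "\<forall>M. is_matroid M \<and> loopless M \<longrightarrow> KL_normalized (rk M) (P M)")
  case True
  have equation_iff: "KL_equation P M \<longleftrightarrow> Z_palindromic P M"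
    if "is_matroid M" "loopless M" "\<And>F. F \<in> flats M \<Longrightarrow> F \<noteq> {} \<Longrightarrow> KL_equation P (contraction M F)" for M
    using that True
    by (intro KL_equation_iff_palindromic KL_normalized_degree_le)
      (auto simp: is_matroid_contraction loopless_contraction)
  have "KL_equation P M"
    if pal: "\<forall>M. is_matroid M \<and> loopless M \<longrightarrow> Z_palindromic P M"
      and "is_matroid M" "loopless M" for M
    using that(2,3)
  proof (induction M rule: loopless_matroid_induct)
    case (contraction M)
    then show ?case using equation_iff[of M] pal by blast
  qed
  then show ?thesis
    using True equation_iff is_matroid_contraction loopless_contraction
    unfolding KL_assignment_iff_KL_equation by meson
qed (auto simp: KL_assignment_iff_KL_equation)

definition KL_step :: "('a matroid \<Rightarrow> int poly) \<Rightarrow> 'a matroid \<Rightarrow> int poly" where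
  "KL_step P M = (if rk M = 0 then 1 else palindromic_completion (rk M) (Z_tail P M))"

lemma KL_step_cong:
  assumes "\<And>F. F \<in> flats M \<Longrightarrow> F \<noteq> {} \<Longrightarrow> P (contraction M F) = Q (contraction M F)"
  shows "KL_step P M = KL_step Q M"
  using assms by (simp add: KL_step_def Z_tail_def)

lemma KL_normalized_KL_step: "KL_normalized (rk M) (KL_step P M)"
  by (simp add: KL_normalized_def KL_step_def degree_palindromic_completion)

lemma palindromic_iff_KL_step:
  assumes M: "is_matroid M" "loopless M"
    and deg: "\<And>F. F \<in> flats M \<Longrightarrow> F \<noteq> {} \<Longrightarrow> degree (P (contraction M F)) \<le> rk (contraction M F)"
  shows "KL_normalized (rk M) (P M) \<and> Z_palindromic P M \<longleftrightarrow> P M = KL_step P M"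
proof (cases "rk M = 0")
  case True
  then have "Z_tail P M = 0" by (simp add: Z_tail_def flats_rk_0[OF M])
  then show ?thesis
    using True by (auto simp: KL_normalized_def KL_step_def Z_sum_eq_add_Z_tail[OF M] rev_poly_def)
next
  case False
  have "degree (Z_tail P M) \<le> rk M" using deg by (rule degree_Z_tail_le[OF M(1)])
  then have "Z_palindromic P M \<longleftrightarrow> P M = KL_step P M"
    if "KL_normalized (rk M) (P M)"
    using that False
    by (simp add: KL_normalized_def KL_step_def Z_sum_eq_add_Z_tail[OF M] rev_poly_add_eq_iff)
  then show ?thesis using KL_normalized_KL_step[of M P] by auto
qed

lemma KL_assignment_iff_KL_step:
  "KL_assignment P \<longleftrightarrow> (\<forall>M. is_matroid M \<and> loopless M \<longrightarrow> P M = KL_step P M)"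
proof (cases "\<forall>M. is_matroid M \<and> loopless M \<longrightarrow> KL_normalized (rk M) (P M)")
  case True
  have "KL_normalized (rk M) (P M) \<and> Z_palindromic P M \<longleftrightarrow> P M = KL_step P M"
    if "is_matroid M" "loopless M" for M
    using that True
    by (intro palindromic_iff_KL_step KL_normalized_degree_le)
      (auto simp: is_matroid_contraction loopless_contraction)
  then show ?thesis by (auto simp: KL_assignment_iff_palindromic)
next
  case False
  then show ?thesis
    unfolding KL_assignment_iff_palindromic using KL_normalized_KL_step by metis
qed

function KL_rec :: "'a matroid \<Rightarrow> int poly" where
  "KL_rec M =
     (if is_matroid M \<and> rk M > 0 then
        palindromic_completion (rk M)
          (\<Sum>F\<in>flats M - {{}}. monom 1 (rank_of M F) * KL_rec (contraction M F))
      else 1)"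
  by pat_completeness auto
termination
  by (relation "measure (\<lambda>M. card (ground M))")
    (auto simp del: ground_contraction intro!: card_ground_contraction_less)

declare KL_rec.simps [simp del]

lemma KL_rec_eq_KL_step: "is_matroid M \<Longrightarrow> KL_rec M = KL_step KL_rec M"
  by (subst KL_rec.simps) (simp add: KL_step_def Z_tail_def)

lemma KL_assignment_iff_KL_rec:
  "KL_assignment P \<longleftrightarrow> (\<forall>M. is_matroid M \<and> loopless M \<longrightarrow> P M = KL_rec M)"
proof -
  have "P M = KL_rec M"
    if "KL_assignment P" "is_matroid M" "loopless M" for M :: "'a matroid"
    using that(2,3)
  proof (induction M rule: loopless_matroid_induct)
    case (contraction M)
    then show ?case
      using that(1) KL_step_cong[of M P KL_rec]
      by (simp add: KL_assignment_iff_KL_step KL_rec_eq_KL_step)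
  qed
  moreover have "KL_assignment P" if "\<forall>M. is_matroid M \<and> loopless M \<longrightarrow> P M = KL_rec M"
    unfolding KL_assignment_iff_KL_step
  proof (intro allI impI, elim conjE)
    fix M :: "'a matroid" assume M: "is_matroid M" "loopless M"
    then have "KL_step P M = KL_step KL_rec M"
      using that by (intro KL_step_cong) (simp add: is_matroid_contraction loopless_contraction)
    then show "P M = KL_step P M" using that M by (simp add: KL_rec_eq_KL_step)
  qed
  ultimately show ?thesis by blast
qed

lemma KL_assignment_KL_poly: "KL_assignment KL_poly"
proof -
  have "KL_poly M = KL_rec M" if "is_matroid M" "loopless M" for M :: "'a matroid"
    unfolding KL_poly_def using that KL_assignment_iff_KL_rec
    by (intro the_equality exI[of _ KL_rec]) auto
  then show ?thesis by (simp add: KL_assignment_iff_KL_rec)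
qed

context
  fixes M :: "'a matroid"
  assumes M: "is_matroid M" "loopless M"
begin

lemma KL_normalized_KL_poly: "KL_normalized (rk M) (KL_poly M)"
  using KL_assignment_KL_poly M unfolding KL_assignment_iff_KL_equation by blast

lemma coeff_KL_poly_eq_0:
  assumes "0 < rk M" "rk M \<le> 2 * i"
  shows "coeff (KL_poly M) i = 0"
  using KL_normalized_KL_poly assms by (intro coeff_eq_0) (simp add: KL_normalized_def)

lemma coeff_Z_poly:
  "coeff (Z_poly M) i =
    (\<Sum>F | F \<in> flats M \<and> rank_of M F \<le> i. coeff (KL_poly (contraction M F)) (i - rank_of M F))"
proof -
  have "coeff (Z_poly M) i =
      (\<Sum>F\<in>flats M. if rank_of M F \<le> i then coeff (KL_poly (contraction M F)) (i - rank_of M F) else 0)"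
    unfolding Z_poly_eq_Z_sum Z_sum_def by (auto simp: coeff_sum coeff_monom_mult intro!: sum.cong)
  also have "\<dots> =
      (\<Sum>F | F \<in> flats M \<and> rank_of M F \<le> i. coeff (KL_poly (contraction M F)) (i - rank_of M F))"
    by (intro sum.inter_filter[symmetric] finite_flats[OF M(1)])
  finally show ?thesis .
qed

end

lemma coeff_Z_poly_rk:
  assumes M: "is_matroid M" "loopless M"
  shows "coeff (Z_poly M) (rk M) = 1"
proof -
  have contr: "is_matroid (contraction M F)" "loopless (contraction M F)"
    "rk (contraction M F) = rk M - rank_of M F" if "F \<in> flats M" for F
    using that flats_subset[OF that]
    by (auto simp: M is_matroid_contraction loopless_contraction rk_contraction)
  have "coeff (KL_poly (contraction M F)) (rk M - rank_of M F) = (if F = ground M then 1 else 0)"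
    if F: "F \<in> flats M" for F
  proof (cases "F = ground M")
    case True
    then show ?thesis
      using KL_normalized_KL_poly[OF contr(1,2)[OF F]] contr(3)[OF F]
      by (simp add: KL_normalized_def rk_def)
  next
    case False
    then show ?thesis
      using rank_of_flat_less_rk[OF M(1) F] coeff_KL_poly_eq_0[OF contr(1,2)[OF F]] contr(3)[OF F]
      by simp
  qed
  then have "coeff (Z_poly M) (rk M) =
      (\<Sum>F | F \<in> flats M \<and> rank_of M F \<le> rk M. if F = ground M then 1 else 0)"
    unfolding coeff_Z_poly[OF M] by (intro sum.cong) auto
  also have "\<dots> = 1"
    using ground_in_flats[of M] finite_flats[OF M(1)] by (simp add: sum.delta' rk_def)
  finally show ?thesis .
qed

lemma coeff_Z_poly_sym:
  assumes M: "is_matroid M" "loopless M" and i: "i \<le> rk M"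
  shows "coeff (Z_poly M) (rk M - i) = coeff (Z_poly M) i"
proof -
  have "degree (Z_poly M) \<le> rk M"
    unfolding Z_poly_eq_Z_sum
    by (intro degree_Z_sum_le KL_normalized_degree_le KL_normalized_KL_poly
        is_matroid_contraction loopless_contraction M)
  moreover have "rev_poly (rk M) (Z_poly M) = Z_poly M"
    using KL_assignment_KL_poly M unfolding KL_assignment_iff_palindromic Z_poly_eq_Z_sum by auto
  ultimately show ?thesis using i by (metis coeff_rev_poly)
qed

lemma coeff_Z_poly_eq_of_upper_half:
  fixes z :: "nat \<Rightarrow> 'b::ring_1"
  assumes M: "is_matroid M" "loopless M"
    and upper_half: "\<And>i. i < rk M \<Longrightarrow> rk M \<le> 2 * i \<Longrightarrow> of_int (coeff (Z_poly M) i) = z i"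
    and sym: "\<And>i. i \<le> rk M \<Longrightarrow> z (rk M - i) = z i" and z_0: "z 0 = 1" and i: "i < rk M"
  shows "of_int (coeff (Z_poly M) i) = z i"
proof -
  consider (upper) "rk M \<le> 2 * i" | (zero) "i = 0" | (lower) "0 < i" "2 * i < rk M" by linarith
  then show ?thesis
  proof cases
    case upper
    then show ?thesis using upper_half i by simp
  next
    case zero
    then show ?thesis using coeff_Z_poly_sym[OF M, of 0] coeff_Z_poly_rk[OF M] z_0 by simp
  next
    case lower
    then show ?thesis
      using coeff_Z_poly_sym[OF M, of i] upper_half[of "rk M - i"] sym[of i] i by simp
  qed
qed

section \<open>Binomial sums\<close>

lemma sum_subsets_card_in:
  fixes g :: "nat \<Rightarrow> 'b::semiring_1"
  assumes "finite E" "finite K"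
  shows "(\<Sum>F | F \<subseteq> E \<and> card F \<in> K. g (card F)) = (\<Sum>k\<in>K. of_nat (card E choose k) * g k)"
proof -
  have "(\<Sum>F | F \<subseteq> E \<and> card F \<in> K. g (card F)) =
      (\<Sum>k\<in>K. \<Sum>F | F \<in> {F. F \<subseteq> E \<and> card F \<in> K} \<and> card F = k. g (card F))"
    using assms by (intro sum.group[symmetric]) auto
  also have "\<dots> = (\<Sum>k\<in>K. \<Sum>F | F \<subseteq> E \<and> card F = k. g k)"
    by (intro sum.cong) auto
  also have "\<dots> = (\<Sum>k\<in>K. of_nat (card E choose k) * g k)"
    by (simp add: n_subsets[OF assms(1)])
  finally show ?thesis .
qed

lemma alternating_sum_choose_Suc:
  fixes f :: "nat \<Rightarrow> 'a::comm_ring_1"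
  shows "(\<Sum>k\<le>Suc n. (-1) ^ k * of_nat (Suc n choose k) * f k) =
    (\<Sum>k\<le>n. (-1) ^ k * of_nat (n choose k) * (f k - f (Suc k)))"
proof -
  have "(\<Sum>k\<le>Suc n. (-1) ^ k * of_nat (Suc n choose k) * f k) =
      f 0 + (\<Sum>k\<le>n. (-1) ^ Suc k * of_nat (n choose Suc k) * f (Suc k)) -
      (\<Sum>k\<le>n. (-1) ^ k * of_nat (n choose k) * f (Suc k))"
    by (subst sum.atMost_Suc_shift) (simp add: algebra_simps sum.distrib sum_subtractf sum_negf)
  also have "f 0 + (\<Sum>k\<le>n. (-1) ^ Suc k * of_nat (n choose Suc k) * f (Suc k)) =
      (\<Sum>k\<le>Suc n. (-1) ^ k * of_nat (n choose k) * f k)"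
    by (subst sum.atMost_Suc_shift) simp
  also have "\<dots> = (\<Sum>k\<le>n. (-1) ^ k * of_nat (n choose k) * f k)"
    by (simp add: binomial_eq_0)
  finally show ?thesis by (simp only: right_diff_distrib sum_subtractf)
qed

lemma gbinomial_diff_Suc:
  fixes x :: "'a::field_char_0"
  shows "(x gchoose Suc k) - (x - 1 gchoose Suc k) = (x - 1 gchoose k)"
  using gbinomial_Suc_Suc[of "x - 1" k] by simp

lemma alternating_sum_choose_gbinomial:
  fixes x :: "'a::field_char_0"
  shows "(\<Sum>k\<le>n. (-1) ^ k * of_nat (n choose k) * (x - of_nat k gchoose r)) =
    (if n \<le> r then x - of_nat n gchoose (r - n) else 0)"
proof (induction n arbitrary: x r)
  case (Suc n)
  show ?case
  proof (cases r)
    case 0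
    then show ?thesis by (subst alternating_sum_choose_Suc) simp
  next
    case r: (Suc q)
    have "(x - of_nat k gchoose Suc q) - (x - of_nat (Suc k) gchoose Suc q) =
        (x - 1 - of_nat k gchoose q)"
      for k
      using gbinomial_diff_Suc[of "x - of_nat k" q] by (simp add: algebra_simps)
    then show ?thesis
      unfolding r alternating_sum_choose_Suc using Suc.IH[of "x - 1" q] by (simp add: algebra_simps)
  qed
qed simp

lemma binomial_inversion:
  fixes f g :: "nat \<Rightarrow> 'a::comm_ring_1"
  assumes g: "\<And>i. g i = (\<Sum>k\<le>i. (-1) ^ k * of_nat (c + i choose k) * f (i - k))"
  shows "(\<Sum>k\<le>i. of_nat (c + i choose k) * g (i - k)) = f i"
proof -
  let ?term = "\<lambda>k l.
      of_nat (c + i choose k) * ((-1) ^ l * of_nat (c + i - k choose l) * f (i - (k + l)))"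
  have "(\<Sum>k\<le>i. of_nat (c + i choose k) * g (i - k)) = (\<Sum>k\<le>i. \<Sum>l\<le>i - k. ?term k l)"
    unfolding g sum_distrib_left by (intro sum.cong refl) simp
  also have "\<dots> = (\<Sum>(k, l)\<in>{(k, l). k + l \<le> i}. ?term k l)"
  proof -
    have "{(k, l). k + l \<le> i} = (SIGMA k:{..i}. {..i - k})" by auto
    then show ?thesis by (simp add: sum.Sigma)
  qed
  also have "\<dots> = (\<Sum>s\<le>i. \<Sum>k\<le>s. ?term k (s - k))"
    by (rule sum.triangle_reindex_eq)
  also have "\<dots> = (\<Sum>s\<le>i. (-1) ^ s * of_nat (c + i choose s) * f (i - s) *
      (\<Sum>k\<le>s. (-1) ^ k * of_nat (s choose k)))"
    unfolding sum_distrib_left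
  proof (intro sum.cong refl)
    fix s k assume "s \<in> {..i}" and k: "k \<in> {..s}"
    then have "of_nat (c + i choose k) * of_nat (c + i - k choose (s - k)) =
        (of_nat (c + i choose s) * of_nat (s choose k) :: 'a)"
      using choose_mult[of k s "c + i"] by (simp flip: of_nat_mult)
    moreover have "(-1 :: 'a) ^ (s - k) = (-1) ^ s * (-1) ^ k"
      using k by (auto simp: le_iff_add power_add mult_ac)
    ultimately show "?term k (s - k) =
        (-1) ^ s * of_nat (c + i choose s) * f (i - s) * ((-1) ^ k * of_nat (s choose k))"
      using k by (simp add: mult_ac)
  qed
  also have "\<dots> = (\<Sum>s\<le>i. if s = 0 then f i else 0)"
    by (intro sum.cong refl) (auto simp: choose_alternating_sum)
  finally show ?thesis by simp
qed

section \<open>The sum in the closed form and its symmetry\<close>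

definition uniform_Z_sum :: "nat \<Rightarrow> nat \<Rightarrow> nat \<Rightarrow> real" where
  "uniform_Z_sum m i j = (\<Sum>h=1..m. (-1) ^ (h + 1) * real h * (real (i + m) gchoose (m - h)) *
     (real j - real h + real m - 1 gchoose (m - 1)))"

text \<open>Applying Pascal's rule to both factors of each summand takes a difference in \<open>i\<close> and one in \<open>j\<close>,
  and lowers \<open>m\<close>. With the constant boundary values this forces symmetry in \<open>i\<close> and \<open>j\<close>.\<close>

lemma uniform_Z_sum_Suc:
  assumes "m > 0"
  shows "uniform_Z_sum (Suc m) (Suc i) (Suc j) =
     uniform_Z_sum (Suc m) i (Suc j) + uniform_Z_sum (Suc m) (Suc i) j - uniform_Z_sum (Suc m) i j +
     uniform_Z_sum m (Suc i) (Suc j)"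
proof -
  obtain p where m: "m = Suc p" using assms gr0_implies_Suc by auto
  let ?left = "\<lambda>i h. real (i + Suc m) gchoose (Suc m - h)"
  let ?right = "\<lambda>j h. real j - real h + real (Suc m) - 1 gchoose m"
  let ?sign = "\<lambda>h. (-1) ^ (h + 1) * real h"
  have left: "?left (Suc i) h - ?left i h = (real (Suc i + m) gchoose (m - h))" if "h \<le> m" for h
    using gbinomial_diff_Suc[of "real (Suc i + Suc m)" "m - h"] that by (simp add: Suc_diff_le)
  have right: "?right (Suc j) h - ?right j h =
      (real (Suc j) - real h + real m - 1 gchoose (m - 1))" for h
    using gbinomial_diff_Suc[of "real (Suc j) - real h + real m" p] by (simp add: m algebra_simps)
  have "uniform_Z_sum (Suc m) (Suc i) (Suc j) - uniform_Z_sum (Suc m) i (Suc j) -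
      uniform_Z_sum (Suc m) (Suc i) j + uniform_Z_sum (Suc m) i j =
      (\<Sum>h=1..Suc m. ?sign h * (?left (Suc i) h - ?left i h) * (?right (Suc j) h - ?right j h))"
    unfolding uniform_Z_sum_def sum_subtractf[symmetric] sum.distrib[symmetric] diff_Suc_1
    by (intro sum.cong refl) (simp only: algebra_simps)
  also have "\<dots> = (\<Sum>h=1..m. ?sign h * (?left (Suc i) h - ?left i h) * (?right (Suc j) h - ?right j h))"
    by (subst sum.cl_ivl_Suc) simp
  also have "\<dots> = uniform_Z_sum m (Suc i) (Suc j)"
    unfolding uniform_Z_sum_def right by (intro sum.cong refl) (subst left, auto)
  finally show ?thesis by simp
qed

lemma uniform_Z_sum_0_right:
  assumes "m > 0"
  shows "uniform_Z_sum m i 0 = real m"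
proof -
  obtain p where m: "m = Suc p" using assms gr0_implies_Suc by auto
  have "real p - real h gchoose p = 0" if "h \<in> {1..p}" for h
  proof -
    have "real p - real h = real (p - h)" "p - h < p" using that by auto
    then show ?thesis by (simp only: binomial_gbinomial[symmetric] binomial_eq_0 of_nat_0)
  qed
  then have "uniform_Z_sum m i 0 = (-1) ^ (m + 1) * real m * (- 1 gchoose p)"
    unfolding uniform_Z_sum_def m by (subst sum.cl_ivl_Suc) (simp add: sum.neutral)
  then show ?thesis
    using gbinomial_minus[of "1::real" p] by (simp add: m binomial_gbinomial[symmetric])
qed

lemma uniform_Z_sum_0_left:
  assumes "m > 0"
  shows "uniform_Z_sum m 0 j = real m"
proof -
  obtain p where m: "m = Suc p" using assms gr0_implies_Suc by auto
  have absorb: "real (Suc k) * (real m gchoose (m - Suc k)) = real m * real (p choose k)"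
    if "k \<le> p" for k
  proof -
    have "real m gchoose (m - Suc k) = real (m choose Suc k)"
      using that binomial_symmetric[of "Suc k" m] by (simp add: m binomial_gbinomial)
    then show ?thesis by (simp only: m Suc_times_binomial flip: of_nat_mult)
  qed
  have "uniform_Z_sum m 0 j = (\<Sum>k\<le>p. (-1) ^ k * (real (Suc k) * (real m gchoose (m - Suc k))) *
      (real (j + p) - 1 - real k gchoose p))"
    unfolding uniform_Z_sum_def m image_Suc_atMost[symmetric]
    by (simp add: sum.reindex algebra_simps)
  also have "\<dots> = real m * (\<Sum>k\<le>p. (-1) ^ k * real (p choose k) * (real (j + p) - 1 - real k gchoose p))"
    unfolding sum_distrib_left by (intro sum.cong refl) (simp only: absorb atMost_iff mult_ac)
  also have "\<dots> = real m"
    by (simp add: alternating_sum_choose_gbinomial)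
  finally show ?thesis .
qed

lemma uniform_Z_sum_commute:
  assumes "m > 0"
  shows "uniform_Z_sum m i j = uniform_Z_sum m j i"
  using assms
proof (induction m arbitrary: i j rule: nat_induct_non_zero)
  case 1
  show ?case by (simp add: uniform_Z_sum_def)
next
  case (Suc m)
  show ?case
  proof (induction "i + j" arbitrary: i j rule: less_induct)
    case less
    show ?case
    proof (cases "i = 0 \<or> j = 0")
      case True
      then show ?thesis by (auto simp: uniform_Z_sum_0_left uniform_Z_sum_0_right)
    next
      case False
      then obtain a b where ij: "i = Suc a" "j = Suc b" by (metis not0_implies_Suc)
      then show ?thesis
        using less[of a j] less[of i b] less[of a b] Suc.IH[of i j]
        by (simp add: uniform_Z_sum_Suc[OF Suc.hyps])
    qed
  qed
qed

section \<open>Coefficients of the uniform matroid of rank \<open>i + j\<close>\<close>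

text \<open>The coefficient of \<open>t\<^sup>i\<close> is indexed by \<open>i\<close> and \<open>j = d - i\<close>: contracting a flat of rank \<open>k\<close> lowers
  \<open>i\<close> by \<open>k\<close> and keeps \<open>m\<close> and \<open>j\<close>.\<close>

definition uniform_Z_coeff :: "nat \<Rightarrow> nat \<Rightarrow> nat \<Rightarrow> real" where
  "uniform_Z_coeff m i j = fact (i + j) * fact (i + j + m) * fact m /
    (fact (i + m) * fact (j + m) * fact i * fact j) * (uniform_Z_sum m i j / real m)"

lemma uniform_Z_coeff_closed_form:
  assumes "i \<le> d"
  shows "uniform_Z_coeff m i (d - i) =
    (real (d + 2 * m) gchoose (i + m)) * (real d gchoose i) / (real (d + 2 * m) gchoose m) *
     (\<Sum>h=1..m. (-1) ^ (h + 1) * real h / real m * (real (i + m) gchoose (m - h)) *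
        ((real d - real i - real h + real m - 1) gchoose (m - 1)))"
proof -
  have "(\<Sum>h=1..m. (-1) ^ (h + 1) * real h / real m * (real (i + m) gchoose (m - h)) *
        ((real d - real i - real h + real m - 1) gchoose (m - 1))) =
      uniform_Z_sum m i (d - i) / real m"
    unfolding uniform_Z_sum_def sum_divide_distrib using assms
    by (intro sum.cong refl) (simp add: of_nat_diff)
  moreover have "(real (d + 2 * m) gchoose (i + m)) =
      fact (d + 2 * m) / (fact (i + m) * fact (d - i + m))"
    using assms binomial_fact[of "i + m" "d + 2 * m", where 'a = real]
    by (simp add: binomial_gbinomial add.commute)
  moreover have "(real (d + 2 * m) gchoose m) = fact (d + 2 * m) / (fact m * fact (d + m))"
    using binomial_fact[of m "d + 2 * m", where 'a = real]
    by (simp add: binomial_gbinomial add.commute)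
  moreover have "(real d gchoose i) = fact d / (fact i * fact (d - i))"
    using assms binomial_fact[of i d, where 'a = real] by (simp add: binomial_gbinomial)
  ultimately show ?thesis
    using assms by (simp add: uniform_Z_coeff_def mult_ac)
qed

lemma uniform_Z_coeff_commute: "m > 0 \<Longrightarrow> uniform_Z_coeff m i j = uniform_Z_coeff m j i"
  unfolding uniform_Z_coeff_def uniform_Z_sum_commute[of m i j] by (simp add: ac_simps)

lemma uniform_Z_coeff_0_left: "m > 0 \<Longrightarrow> uniform_Z_coeff m 0 j = 1"
  by (simp add: uniform_Z_coeff_def uniform_Z_sum_0_left)

text \<open>Binomial inversion of the relation that expresses \<open>Z\<close> through the Kazhdan--Lusztig polynomials.\<close>

definition uniform_KL_coeff :: "nat \<Rightarrow> nat \<Rightarrow> nat \<Rightarrow> real" where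
  "uniform_KL_coeff m i j =
    (\<Sum>k\<le>i. (-1) ^ k * real (m + j + i choose k) * uniform_Z_coeff m (i - k) j)"

lemma uniform_Z_coeff_eq_add_sum:
  "uniform_Z_coeff m i j =
    uniform_KL_coeff m i j + (\<Sum>k=1..i. real (m + j + i choose k) * uniform_KL_coeff m (i - k) j)"
proof -
  have "uniform_Z_coeff m i j = (\<Sum>k\<le>i. real (m + j + i choose k) * uniform_KL_coeff m (i - k) j)"
    using binomial_inversion[of "\<lambda>i. uniform_KL_coeff m i j" "m + j" "\<lambda>i. uniform_Z_coeff m i j" i]
    by (simp add: uniform_KL_coeff_def)
  also have "{..i} = insert 0 {1..i}" by auto
  finally show ?thesis by simp
qed

definition uniform_Z_weight :: "nat \<Rightarrow> nat \<Rightarrow> nat \<Rightarrow> real" where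
  "uniform_Z_weight m j h =
    (-1) ^ (h + 1) * real h * (real j - real h + real m - 1 gchoose (m - 1)) *
    fact (j - h) / fact (m - h)"

text \<open>For fixed \<open>m\<close> and \<open>j\<close> the right-hand side is a polynomial in \<open>a\<close> of degree less than \<open>j\<close>.\<close>

lemma uniform_Z_sum_polynomial:
  assumes "j > 0"
  shows "fact (a + j) / fact (a + m) * uniform_Z_sum m a j =
    (\<Sum>h\<in>{1..m} \<inter> {..j}. uniform_Z_weight m j h * (real (a + j) gchoose (j - h)))"
proof -
  let ?right = "\<lambda>h. real j - real h + real m - 1 gchoose (m - 1)"
  have "?right h = 0" if "h \<in> {1..m}" "j < h" for h
  proof -
    have "real j - real h + real m - 1 = real (j + m - 1 - h)" "j + m - 1 - h < m - 1"
      using that assms by (auto simp: of_nat_diff)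
    then show ?thesis by (simp only: binomial_gbinomial[symmetric] binomial_eq_0 of_nat_0)
  qed
  then have "uniform_Z_sum m a j =
      (\<Sum>h\<in>{1..m} \<inter> {..j}. (-1) ^ (h + 1) * real h * (real (a + m) gchoose (m - h)) * ?right h)"
    unfolding uniform_Z_sum_def by (intro sum.mono_neutral_right) auto
  moreover have "fact (a + j) / fact (a + m) *
      ((-1) ^ (h + 1) * real h * (real (a + m) gchoose (m - h)) * ?right h) =
      uniform_Z_weight m j h * (real (a + j) gchoose (j - h))" if "h \<in> {1..m} \<inter> {..j}" for h
  proof -
    have "(real (a + m) gchoose (m - h)) = fact (a + m) / (fact (m - h) * fact (a + h))"
      "(real (a + j) gchoose (j - h)) = fact (a + j) / (fact (j - h) * fact (a + h))"
      using that binomial_fact[of "m - h" "a + m", where 'a = real]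
        binomial_fact[of "j - h" "a + j", where 'a = real]
      by (simp_all add: binomial_gbinomial)
    then show ?thesis by (simp add: uniform_Z_weight_def)
  qed
  ultimately show ?thesis by (simp add: sum_distrib_left)
qed

lemma choose_mult_uniform_Z_coeff:
  assumes "k \<le> i"
  shows "real (m + j + i choose k) * uniform_Z_coeff m (i - k) j =
    fact (m + j + i) * fact m / (fact (j + m) * fact j * fact i * real m) *
    (real (i choose k) * (fact (i - k + j) / fact (i - k + m) * uniform_Z_sum m (i - k) j))"
proof -
  have "m + j + i - k = i - k + j + m" using assms by simp
  then have "real (m + j + i choose k) = fact (m + j + i) / (fact k * fact (i - k + j + m))"
    using assms by (simp add: binomial_fact)
  moreover have "real (i choose k) = fact i / (fact k * fact (i - k))"
    using assms by (rule binomial_fact)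
  ultimately show ?thesis by (simp add: uniform_Z_coeff_def mult_ac)
qed

lemma uniform_KL_coeff_eq_0:
  assumes "0 < j" "j \<le> i"
  shows "uniform_KL_coeff m i j = 0"
proof -
  let ?const = "fact (m + j + i) * fact m / (fact (j + m) * fact j * fact i * real m) :: real"
  let ?H = "{1..m} \<inter> {..j}"
  let ?alt = "\<lambda>h k. (-1) ^ k * real (i choose k) * (real (i + j) - real k gchoose (j - h))"
  have "uniform_KL_coeff m i j = (\<Sum>k\<le>i. ?const * (\<Sum>h\<in>?H. uniform_Z_weight m j h * ?alt h k))"
    unfolding uniform_KL_coeff_def
  proof (intro sum.cong refl)
    fix k assume k: "k \<in> {..i}"
    then have "real (i - k + j) = real (i + j) - real k" by (simp add: of_nat_diff)
    then show "(-1) ^ k * real (m + j + i choose k) * uniform_Z_coeff m (i - k) j =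
        ?const * (\<Sum>h\<in>?H. uniform_Z_weight m j h * ?alt h k)"
      using k
      by (simp only: mult.assoc choose_mult_uniform_Z_coeff atMost_iff
          uniform_Z_sum_polynomial[OF assms(1)])
        (simp add: sum_distrib_left mult_ac)
  qed
  also have "\<dots> = ?const * (\<Sum>h\<in>?H. uniform_Z_weight m j h * (\<Sum>k\<le>i. ?alt h k))"
    unfolding sum_distrib_left by (rule sum.swap)
  also have "(\<Sum>h\<in>?H. uniform_Z_weight m j h * (\<Sum>k\<le>i. ?alt h k)) = 0"
    using assms by (intro sum.neutral) (auto simp: alternating_sum_choose_gbinomial)
  finally show ?thesis by simp
qed

section \<open>Uniform matroids\<close>

lemma ground_uniform_matroid [simp]: "ground (uniform_matroid E d) = E"
  by (simp add: uniform_matroid_def)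

lemma indep_uniform_matroid [simp]: "indep (uniform_matroid E d) = {I. I \<subseteq> E \<and> card I \<le> d}"
  by (simp add: uniform_matroid_def)

lemma loopless_uniform: "d > 0 \<Longrightarrow> loopless (uniform_matroid E d)"
  by (simp add: loopless_def)

context
  fixes E :: "'a set"
  assumes fin: "finite E"
begin

lemma is_matroid_uniform: "is_matroid (uniform_matroid E d)"
  unfolding is_matroid_def
proof (intro conjI ballI allI impI)
  fix I J assume I: "I \<in> indep (uniform_matroid E d)" and J: "J \<in> indep (uniform_matroid E d)"
    and less: "card I < card J"
  have finite_IJ: "finite I" "finite J" using I J fin by (auto intro: finite_subset)
  then obtain x where "x \<in> J - I"
    using less card_mono[of I J] by (metis Diff_eq_empty_iff all_not_in_conv not_le)
  then show "\<exists>x\<in>J - I. insert x I \<in> indep (uniform_matroid E d)"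
    using I J less finite_IJ by (intro bexI[of _ x]) auto
next
  fix I J assume "I \<in> indep (uniform_matroid E d)" "J \<subseteq> I"
  then show "J \<in> indep (uniform_matroid E d)"
    using fin card_mono[of I J] by (auto intro: finite_subset order_trans)
qed (use fin in auto)

lemma rank_of_uniform:
  assumes "A \<subseteq> E"
  shows "rank_of (uniform_matroid E d) A = min (card A) d"
proof (rule antisym)
  obtain B where "is_basis (uniform_matroid E d) A B" using obtain_basis[OF is_matroid_uniform] .
  then show "rank_of (uniform_matroid E d) A \<le> min (card A) d"
    using rank_of_le_card[OF is_matroid_uniform, of A] finite_subset[OF assms fin]
    by (auto simp: is_basis_def)
  obtain C where "C \<subseteq> A" "card C = min (card A) d"
    by (rule obtain_subset_with_card_n[of "min (card A) d" A]) simp_all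
  then show "min (card A) d \<le> rank_of (uniform_matroid E d) A"
    using card_le_rank_of[OF is_matroid_uniform[of d], of C A] assms by auto
qed

lemma rk_uniform: "d \<le> card E \<Longrightarrow> rk (uniform_matroid E d) = d"
  by (simp add: rk_def rank_of_uniform)

lemma flats_uniform_rank_le:
  assumes "i < d"
  shows "{F \<in> flats (uniform_matroid E d). rank_of (uniform_matroid E d) F \<le> i} =
    {F. F \<subseteq> E \<and> card F \<le> i}"
proof -
  have "rank_of (uniform_matroid E d) F < rank_of (uniform_matroid E d) (insert x F)"
    if "F \<subseteq> E" "card F \<le> i" "x \<in> E - F" for F x
    using that assms finite_subset[OF that(1) fin] by (simp add: rank_of_uniform)
  then show ?thesis
    using assms by (auto simp: flats_def rank_of_uniform)
qed

lemma contraction_uniform: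
  assumes "F \<subseteq> E" "card F \<le> d"
  shows "contraction (uniform_matroid E d) F = uniform_matroid (E - F) (d - card F)"
proof -
  have "I \<in> indep (contraction (uniform_matroid E d) F) \<longleftrightarrow> I \<subseteq> E - F \<and> card I \<le> d - card F" for I
  proof (cases "I \<subseteq> E - F")
    case True
    have "finite I" "finite F" using True assms(1) fin by (auto intro: finite_subset)
    then have "card (I \<union> F) = card I + card F" using True by (intro card_Un_disjoint) auto
    moreover have "I \<union> F \<subseteq> E" using True assms(1) by auto
    ultimately show ?thesis
      using True assms
      by (auto simp: indep_contraction_iff_rank[OF is_matroid_uniform] rank_of_uniform)
  qed (simp add: contraction_def)
  then show ?thesis by (intro matroid.expand) (simp add: set_eq_iff)
qed

lemma coeff_Z_poly_uniform:
  assumes "i < d"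
  shows "coeff (Z_poly (uniform_matroid E d)) i = coeff (KL_poly (uniform_matroid E d)) i +
    (\<Sum>F | F \<subseteq> E \<and> card F \<in> {1..i}.
      coeff (KL_poly (uniform_matroid (E - F) (d - card F))) (i - card F))"
proof -
  let ?KL = "\<lambda>F. coeff (KL_poly (uniform_matroid (E - F) (d - card F))) (i - card F)"
  have "coeff (Z_poly (uniform_matroid E d)) i = (\<Sum>F | F \<subseteq> E \<and> card F \<le> i. ?KL F)"
    using assms
    by (simp add: coeff_Z_poly is_matroid_uniform loopless_uniform flats_uniform_rank_le)
      (simp add: contraction_uniform rank_of_uniform)
  also have "{F. F \<subseteq> E \<and> card F \<le> i} = insert {} {F. F \<subseteq> E \<and> card F \<in> {1..i}}"
  proof -
    have "card F = 0 \<longleftrightarrow> F = {}" if "F \<subseteq> E" for F using finite_subset[OF that fin] by simp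
    then show ?thesis by (auto simp: Suc_le_eq simp flip: neq0_conv)
  qed
  finally show ?thesis using fin by simp
qed

end

lemma coeff_Z_poly_uniform_diff:
  assumes E: "finite E" "card E = m + d" and i: "i < d"
    and KL: "\<And>F. F \<subseteq> E \<Longrightarrow> card F \<in> {1..i} \<Longrightarrow>
      real_of_int (coeff (KL_poly (uniform_matroid (E - F) (d - card F))) (i - card F)) =
      uniform_KL_coeff m (i - card F) (d - i)"
  shows "real_of_int (coeff (Z_poly (uniform_matroid E d)) i) -
      coeff (KL_poly (uniform_matroid E d)) i =
    uniform_Z_coeff m i (d - i) - uniform_KL_coeff m i (d - i)"
proof -
  have "real_of_int (coeff (Z_poly (uniform_matroid E d)) i) -
      coeff (KL_poly (uniform_matroid E d)) i =
      (\<Sum>F | F \<subseteq> E \<and> card F \<in> {1..i}. uniform_KL_coeff m (i - card F) (d - i))"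
    using KL by (simp add: coeff_Z_poly_uniform[OF E(1) i])
  also have "\<dots> = (\<Sum>k=1..i. real (card E choose k) * uniform_KL_coeff m (i - k) (d - i))"
    using E(1) by (intro sum_subsets_card_in) auto
  also have "card E = m + (d - i) + i" using E(2) i by simp
  finally show ?thesis by (simp add: uniform_Z_coeff_eq_add_sum[of m i "d - i"])
qed

lemma coeffs_uniform_matroid:
  assumes "m > 0" "finite E" "card E = m + d" "i < d"
  shows "real_of_int (coeff (KL_poly (uniform_matroid E d)) i) = uniform_KL_coeff m i (d - i) \<and>
    real_of_int (coeff (Z_poly (uniform_matroid E d)) i) = uniform_Z_coeff m i (d - i)"
  using assms(2-)
proof (induction d arbitrary: E i rule: less_induct)
  case (less d)
  let ?M = "uniform_matroid E d"
  have M: "is_matroid ?M" "loopless ?M" and rk: "rk ?M = d"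
    using less.prems by (auto intro: is_matroid_uniform loopless_uniform rk_uniform)
  have diff: "real_of_int (coeff (Z_poly ?M) i) - coeff (KL_poly ?M) i =
      uniform_Z_coeff m i (d - i) - uniform_KL_coeff m i (d - i)" if i: "i < d" for i
  proof (rule coeff_Z_poly_uniform_diff[OF less.prems(1,2) i])
    fix F assume F: "F \<subseteq> E" "card F \<in> {1..i}"
    have "card (E - F) = m + (d - card F)"
      using F i less.prems by (subst card_Diff_subset) (auto intro: finite_subset)
    moreover have "d - card F - (i - card F) = d - i" using F i by auto
    ultimately show
      "real_of_int (coeff (KL_poly (uniform_matroid (E - F) (d - card F))) (i - card F)) =
        uniform_KL_coeff m (i - card F) (d - i)"
      using less.IH[of "d - card F" "E - F" "i - card F"] F i less.prems(1) by auto
  qed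
  have "real_of_int (coeff (Z_poly ?M) i) = uniform_Z_coeff m i (d - i)"
  proof (rule coeff_Z_poly_eq_of_upper_half[OF M], unfold rk)
    fix i assume "i < d" "d \<le> 2 * i"
    then show "real_of_int (coeff (Z_poly ?M) i) = uniform_Z_coeff m i (d - i)"
      using diff[of i] uniform_KL_coeff_eq_0[of "d - i" i m] coeff_KL_poly_eq_0[OF M, of i] rk
      by simp
  next
    fix i assume "i \<le> d"
    then show "uniform_Z_coeff m (d - i) (d - (d - i)) = uniform_Z_coeff m i (d - i)"
      using uniform_Z_coeff_commute[OF assms(1)] by simp
  qed (use uniform_Z_coeff_0_left assms(1) less.prems in auto)
  then show ?case using diff[OF less.prems(3)] by simp
qed

theorem theorem3p1:
  fixes m d :: nat and E :: "'a set"
  assumes "m > 0" and "d > 0" and "finite E" and "card E = m + d"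
  shows "coeff (Z_poly (uniform_matroid E d)) d = 1 \<and>
    (\<forall>i\<le>d - 1. real_of_int (coeff (Z_poly (uniform_matroid E d)) i) =
       (real (d + 2 * m) gchoose (i + m)) * (real d gchoose i) / (real (d + 2 * m) gchoose m) *
       (\<Sum>h=1..m. (-1) ^ (h + 1) * real h / real m * (real (i + m) gchoose (m - h)) *
          ((real d - real i - real h + real m - 1) gchoose (m - 1))))"
proof (intro conjI allI impI)
  show "coeff (Z_poly (uniform_matroid E d)) d = 1"
    using assms coeff_Z_poly_rk[OF is_matroid_uniform loopless_uniform, of E d]
    by (simp add: rk_uniform)
  fix i assume "i \<le> d - 1"
  then have i: "i < d" using assms(2) by simp
  show "real_of_int (coeff (Z_poly (uniform_matroid E d)) i) =
       (real (d + 2 * m) gchoose (i + m)) * (real d gchoose i) / (real (d + 2 * m) gchoose m) *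
       (\<Sum>h=1..m. (-1) ^ (h + 1) * real h / real m * (real (i + m) gchoose (m - h)) *
          ((real d - real i - real h + real m - 1) gchoose (m - 1)))"
    using coeffs_uniform_matroid[OF assms(1,3,4) i]
    unfolding uniform_Z_coeff_closed_form[OF less_imp_le[OF i]] by (rule conjunct2)
qed

end
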